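(* Let $r\in\mathbb{N}$ and $i\in\{0,1\}$. Then, as formal power series, $$\sum_{n=0}^{\infty}\frac{D^{(i)}_r(n)}{n!}x^n=\frac12\left(\frac{x^r e^{-x}}{(1-x)^{r+1}}+(-1)^{r+i}\frac{x^r e^{-x}}{(1+x)^{r-1}}\right).$$
   Context: $\mathbb{N}$ denotes the non-negative integers. $D^{(i)}_r(n)$ is the number of permutations $\sigma$ of $\{1,\ldots,r+n\}$ with no fixed points, such that any two distinct elements of $\{1,\ldots,r\}$ lie in different cycles of $\sigma$, and with parity $i$ (parity $0$ = even, $1$ = odd). *)

theory Defs
  imports "HOL-Combinatorics.Combinatorics"
    "HOL-Computational_Algebra.Formal_Power_Series"
begin

(* For a permutation p, "orbit p a" is the set of elements of the cycle of p through a. *)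
definition r_derangements :: "nat \<Rightarrow> nat \<Rightarrow> (nat \<Rightarrow> nat) set" where
  "r_derangements r n =
    {p. p permutes {1..r + n} \<and>
        (\<forall>k \<in> {1..r + n}. p k \<noteq> k) \<and>
        (\<forall>a \<in> {1..r}. \<forall>b \<in> {1..r}. a \<noteq> b \<longrightarrow> orbit p a \<noteq> orbit p b)}"

(* The parity index i is meant to be 0 (even permutations) or 1 (odd permutations). *)
definition r_derangement_parity_number :: "nat \<Rightarrow> nat \<Rightarrow> nat \<Rightarrow> nat" where
  "r_derangement_parity_number i r n =
    card {p \<in> r_derangements r n. evenperm p \<longleftrightarrow> i = 0}"

end

theory Submission
  imports Defs
begin

text \<open>
  Count permutations with weight \<open>1\<close> if even and \<open>c\<close> if odd, where \<open>c = 1\<close> or \<open>c = -1\<close>; the two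
  parity classes are half the sum and half the difference of the two weighted counts \<open>W\<^sub>c(r, n)\<close>.
  Deleting a non-distinguished element from its cycle leaves a permutation whose only possible
  fixed point is the predecessor \<open>b\<close> of that element. Distinguishing whether \<open>b\<close> is fixed, and if
  so whether it is one of the \<open>r\<close> distinguished elements, gives
  \[ W_c(r, n+1) = c\,((r+n) W_c(r,n) + n W_c(r,n-1) + r W_c(r-1,n)). \]
  The exponential generating function
  \[ G_r = e^{-x} \left(\frac{c x}{1 - c x}\right)^r (1 - c x)^{-c} \]
  satisfies the corresponding differential equation
  \[ (1 - c x) G_r' = c x G_r + r c\, G_{r-1} + r c\, G_r. \]
\<close>

section \<open>Permutations with separated elements\<close>

text \<open>Arbitrary sets replace the two intervals so that deleting a point stays within the same
  family and needs no relabelling.\<close>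

definition separated_derangements :: "'a set \<Rightarrow> 'a set \<Rightarrow> ('a \<Rightarrow> 'a) set" where
  "separated_derangements S R =
    {p. p permutes S \<and> (\<forall>k\<in>S. p k \<noteq> k) \<and> pairwise (\<lambda>x y. orbit p x \<noteq> orbit p y) R}"

text \<open>\<open>c = 1\<close> gives plain counting and \<open>c = - 1\<close> the sign; both are
  multiplicative under composition.\<close>

definition parity_weight :: "'b::comm_ring_1 \<Rightarrow> ('a \<Rightarrow> 'a) \<Rightarrow> 'b" where
  "parity_weight c p = (if evenperm p then 1 else c)"

definition weighted_count :: "'b::comm_ring_1 \<Rightarrow> 'a set \<Rightarrow> 'a set \<Rightarrow> 'b" where
  "weighted_count c S R = (\<Sum>p\<in>separated_derangements S R. parity_weight c p)"

lemma finite_separated_derangements: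
  "finite S \<Longrightarrow> finite (separated_derangements S R)"
  by (rule finite_subset[OF _ finite_permutations]) (auto simp: separated_derangements_def)

lemma r_derangements_eq: "r_derangements r n = separated_derangements {1..r + n} {1..r}"
  by (simp add: r_derangements_def separated_derangements_def pairwise_def)

section \<open>Inserting a new point into a cycle\<close>

lemma orbit_eq_iff:
  assumes "permutation p"
  shows "orbit p x = orbit p y \<longleftrightarrow> y \<in> orbit p x"
  using assms cyclic_on_orbit' orbit_cyclic_eq3 permutation_self_in_orbit by metis

text \<open>The composition inserts \<open>a\<close> just before \<open>b\<close>: the
  \<open>q\<close>-preimage of \<open>b\<close> now goes to \<open>a\<close>, and \<open>a\<close>
  goes to \<open>b\<close>. This detour does not change which old points share a cycle.\<close>

lemma orbit_transpose_comp_iff: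
  assumes q: "q permutes S" and a: "a \<notin> S" and b: "b \<in> S"
    and x: "x \<in> S" and y: "y \<in> S"
  defines "p \<equiv> transpose a b \<circ> q"
  shows "y \<in> orbit p x \<longleftrightarrow> y \<in> orbit q x"
proof
  have qS: "q z \<in> S" if "z \<in> S" for z
    using q that by (simp add: permutes_in_image)
  have qa: "q a = a" using q a by (simp add: permutes_not_in)
  have pa: "p a = b" by (simp add: p_def qa)
  have pb: "p z = a" if "q z = b" for z using that by (simp add: p_def)
  have pz: "p z = q z" if "z \<in> S" "q z \<noteq> b" for z
    using that qS[of z] a by (auto simp: p_def transpose_def)
  \<comment> \<open>A step of \<open>q\<close> is one step of \<open>p\<close>, or two steps through
    \<open>a\<close> if it lands on \<open>b\<close>.\<close>
  have step: "q z \<in> orbit p z" if "z \<in> S" for z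
    using that pa pb pz by (cases "q z = b") (metis orbit.intros)+
  show "y \<in> orbit p x" if "y \<in> orbit q x"
  proof -
    from that have "y \<in> orbit p x \<and> y \<in> S"
      by induct (use step qS x orbit_trans in \<open>fast+\<close>)
    then show ?thesis ..
  qed
  show "y \<in> orbit q x" if "y \<in> orbit p x"
  proof -
    \<comment> \<open>The walk under \<open>p\<close> may stand at \<open>a\<close>, which lies
      outside the \<open>q\<close>-orbit of \<open>x\<close>; there the invariant speaks of
      \<open>b\<close>, the next point.\<close>
    from that have "(if y = a then b \<in> orbit q x else y \<in> S \<and> y \<in> orbit q x)"
    proof induct
      case base
      show ?case
        using x pb[of x] pz[of x] qS[of x] a orbit.base[of q x] by (cases "q x = b") auto
    next
      case (step y)
      show ?case
      proof (cases "y = a")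
        case True
        with step a b pa show ?thesis by auto
      next
        case False
        with step have "y \<in> S" "y \<in> orbit q x" by auto
        then show ?thesis
          using pb[of y] pz[of y] qS[of y] a orbit.step[of y q x] by (cases "q y = b") auto
      qed
    qed
    with y a show ?thesis by (auto split: if_splits)
  qed
qed

text \<open>Insertion creates no fixed point and destroys at most the one at \<open>b\<close>, so
  \<open>q\<close> may fix \<open>b\<close> but nothing else in \<open>S\<close>.\<close>

lemma transpose_comp_separated_iff:
  assumes q: "q permutes S" and fin: "finite S" and a: "a \<notin> S" and b: "b \<in> S" and R: "R \<subseteq> S"
  shows "transpose a b \<circ> q \<in> separated_derangements (insert a S) R \<longleftrightarrow>
    (\<forall>k\<in>S. q k = k \<longrightarrow> k = b) \<and> pairwise (\<lambda>x y. orbit q x \<noteq> orbit q y) R"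
proof -
  let ?p = "transpose a b \<circ> q"
  have "?p permutes insert a S"
    using permutes_imp_permutes_insert[OF q] b by (intro permutes_compose permutes_swap_id) auto
  moreover have "permutation ?p" "permutation q"
    using calculation q fin by (auto simp: permutation_permutes)
  then have "orbit ?p x = orbit ?p y \<longleftrightarrow> orbit q x = orbit q y" if "x \<in> R" "y \<in> R" for x y
    using orbit_transpose_comp_iff[OF q a b] that R by (simp add: orbit_eq_iff subset_iff)
  then have "pairwise (\<lambda>x y. orbit ?p x \<noteq> orbit ?p y) R \<longleftrightarrow>
      pairwise (\<lambda>x y. orbit q x \<noteq> orbit q y) R"
    by (auto simp: pairwise_def)
  moreover have "(\<forall>k\<in>insert a S. ?p k \<noteq> k) \<longleftrightarrow> (\<forall>k\<in>S. q k = k \<longrightarrow> k = b)"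
  proof -
    have "q a = a" using q a by (simp add: permutes_not_in)
    moreover have "q k \<noteq> a" if "k \<in> S" for k
      using that q a permutes_in_image[OF q, of k] by auto
    ultimately show ?thesis using a b by (auto simp: transpose_def)
  qed
  ultimately show ?thesis
    by (simp only: separated_derangements_def mem_Collect_eq simp_thms)
qed

text \<open>A fixed point forms a cycle alone, so its separation from the rest of \<open>R\<close>
  is automatic. This turns the case of a fixed \<open>b\<close>, distinguished or not, into a
  smaller instance.\<close>

lemma separated_derangements_remove_iff:
  assumes fin: "finite S" and b: "b \<in> S"
  shows "q \<in> separated_derangements (S - {b}) (R - {b}) \<longleftrightarrow>
    q permutes S \<and> (\<forall>k\<in>S. q k = k \<longleftrightarrow> k = b) \<and> pairwise (\<lambda>x y. orbit q x \<noteq> orbit q y) R"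
    (is "?lhs \<longleftrightarrow> ?rhs")
proof -
  have perm: "q permutes S - {b} \<longleftrightarrow> q permutes S \<and> q b = b"
    using permutes_subset[of q "S - {b}" S] permutes_superset[of q S "S - {b}"]
    by (auto simp: permutes_not_in)
  have "pairwise (\<lambda>x y. orbit q x \<noteq> orbit q y) (R - {b}) \<longleftrightarrow>
      pairwise (\<lambda>x y. orbit q x \<noteq> orbit q y) R" if "q permutes S" "q b = b"
  proof -
    have "permutation q" using that fin by (auto simp: permutation_permutes)
    moreover have "orbit q b = {b}" using that by (simp add: orbit_eq_singleton_iff)
    ultimately have "orbit q x \<noteq> orbit q b" "orbit q b \<noteq> orbit q x" if "x \<noteq> b" for x
      using that permutation_self_in_orbit[of q x] by auto
    then show ?thesis unfolding pairwise_def by (metis Diff_iff singletonD)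
  qed
  with perm b show ?thesis by (auto simp: separated_derangements_def)
qed

section \<open>The recursion for weighted counts\<close>

lemma parity_weight_transpose_comp:
  assumes "permutation q" "a \<noteq> b" "c * c = 1"
  shows "parity_weight c (transpose a b \<circ> q) = c * parity_weight c q"
  using assms by (simp add: parity_weight_def evenperm_comp permutation_swap_id evenperm_swap)

text \<open>Each permutation of \<open>insert a S\<close> is uniquely
  \<open>transpose a b \<circ> q\<close> with \<open>q\<close> permuting \<open>S\<close> and
  \<open>b\<close> the image of \<open>a\<close>. For \<open>b\<close> in \<open>S\<close>, the two
  summands count the \<open>q\<close> without fixed points and those fixing \<open>b\<close> alone;
  the transposition contributes the factor \<open>c\<close>.\<close>

lemma weighted_count_insert:
  fixes c :: "'b::comm_ring_1"
  assumes fin: "finite S" and a: "a \<notin> S" and R: "R \<subseteq> S" and c: "c * c = 1"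
  shows "weighted_count c (insert a S) R =
    c * (\<Sum>b\<in>S. weighted_count c S R + weighted_count c (S - {b}) (R - {b}))"
proof -
  let ?D = "separated_derangements (insert a S) R"
  let ?P = "{q. q permutes S}"
  have *: "(\<Sum>q\<in>?P. if transpose a b \<circ> q \<in> ?D then parity_weight c (transpose a b \<circ> q) else 0) =
      c * (weighted_count c S R + weighted_count c (S - {b}) (R - {b}))" if b: "b \<in> S" for b
  proof -
    let ?A = "separated_derangements S R" and ?B = "separated_derangements (S - {b}) (R - {b})"
    define sep where "sep q = pairwise (\<lambda>x y. orbit q x \<noteq> orbit q y) R" for q
    have D: "transpose a b \<circ> q \<in> ?D \<longleftrightarrow> (\<forall>k\<in>S. q k = k \<longrightarrow> k = b) \<and> sep q"
      if "q permutes S" for q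
      using transpose_comp_separated_iff[OF that fin a b R] by (simp only: sep_def)
    have A: "q \<in> ?A \<longleftrightarrow> q permutes S \<and> (\<forall>k\<in>S. q k \<noteq> k) \<and> sep q" for q
      by (simp only: separated_derangements_def sep_def mem_Collect_eq)
    have B: "q \<in> ?B \<longleftrightarrow> q permutes S \<and> (\<forall>k\<in>S. q k = k \<longleftrightarrow> k = b) \<and> sep q" for q
      unfolding sep_def by (rule separated_derangements_remove_iff[OF fin b])
    have "(\<Sum>q\<in>?P. if transpose a b \<circ> q \<in> ?D then parity_weight c (transpose a b \<circ> q) else 0) =
        (\<Sum>q\<in>{q\<in>?P. transpose a b \<circ> q \<in> ?D}. parity_weight c (transpose a b \<circ> q))"
      by (rule sum.inter_filter[symmetric]) (simp add: fin finite_permutations)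
    also have "{q\<in>?P. transpose a b \<circ> q \<in> ?D} = ?A \<union> ?B"
    proof (rule set_eqI)
      fix q
      show "q \<in> {q\<in>?P. transpose a b \<circ> q \<in> ?D} \<longleftrightarrow> q \<in> ?A \<union> ?B"
        unfolding Un_iff A B mem_Collect_eq using D[of q] by metis
    qed
    also have "(\<Sum>q\<in>?A \<union> ?B. parity_weight c (transpose a b \<circ> q)) =
        (\<Sum>q\<in>?A \<union> ?B. c * parity_weight c q)"
    proof (rule sum.cong[OF refl])
      fix q assume "q \<in> ?A \<union> ?B"
      then have "q permutes S"
        unfolding Un_iff A B by blast
      then show "parity_weight c (transpose a b \<circ> q) = c * parity_weight c q"
        using fin a b c by (intro parity_weight_transpose_comp) (auto simp: permutation_permutes)
    qed
    also have "\<dots> = c * ((\<Sum>q\<in>?A. parity_weight c q) + (\<Sum>q\<in>?B. parity_weight c q))"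
    proof (subst sum.union_disjoint)
      show "?A \<inter> ?B = {}"
        using b A B by blast
    qed (simp_all add: fin finite_separated_derangements sum_distrib_left distrib_left)
    finally show ?thesis by (simp only: weighted_count_def)
  qed
  \<comment> \<open>For \<open>b = a\<close> the composite is \<open>q\<close> itself, which fixes
    \<open>a\<close>.\<close>
  have "q \<notin> ?D" if "q permutes S" for q
    using that a by (auto simp: separated_derangements_def permutes_not_in)
  then have a0: "(\<Sum>q\<in>?P. if transpose a a \<circ> q \<in> ?D
      then parity_weight c (transpose a a \<circ> q) else 0) = 0"
    by (intro sum.neutral) simp
  have "weighted_count c (insert a S) R =
      (\<Sum>p\<in>{p. p permutes insert a S}. if p \<in> ?D then parity_weight c p else 0)"
    unfolding weighted_count_def
    by (subst sum.inter_filter[symmetric])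
       (auto simp: fin finite_permutations separated_derangements_def intro!: sum.cong)
  also have "\<dots> = c * (\<Sum>b\<in>S. weighted_count c S R + weighted_count c (S - {b}) (R - {b}))"
    unfolding sum_over_permutations_insert[OF fin a] sum.insert[OF fin a] a0
    by (simp add: * sum_distrib_left)
  finally show ?thesis .
qed

text \<open>A point and its image share an orbit, so a derangement of a nonempty set cannot separate
  all its points. This is the base case of the later induction.\<close>

lemma separated_derangements_same:
  assumes "finite S"
  shows "separated_derangements S S = (if S = {} then {id} else {})"
proof -
  have False if p: "p \<in> separated_derangements S S" and x: "x \<in> S" for p x
  proof -
    have "p permutes S" "p x \<noteq> x" and sep: "pairwise (\<lambda>x y. orbit p x \<noteq> orbit p y) S"
      using p x by (auto simp: separated_derangements_def)
    moreover have "p x \<in> S" using x \<open>p permutes S\<close> by (simp add: permutes_in_image)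
    moreover have "orbit p (p x) = orbit p x"
      using \<open>p permutes S\<close> assms by (metis permutation_permutes permutation_orbit_step)
    ultimately show False using x by (auto simp: pairwise_def)
  qed
  then show ?thesis by (auto simp: separated_derangements_def)
qed

section \<open>The generating function\<close>

unbundle fps_syntax

text \<open>\<open>H\<close> stands for (1 - c x)^(-c), given by its differential equation and
  constant term. This treats 1/(1 - x) and 1 + x at once.\<close>

locale parity_gf =
  fixes c :: "'a::field_char_0" and H :: "'a fps"
  assumes c_square: "c * c = 1"
    and H_0: "H $ 0 = 1"
    and H_deriv: "(1 - fps_const c * fps_X) * fps_deriv H = H"
begin

definition U :: "'a fps" where "U = inverse (1 - fps_const c * fps_X)"

definition G :: "nat \<Rightarrow> 'a fps" where
  "G r = fps_exp (- 1) * (fps_const c * fps_X * U) ^ r * H"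

lemma U_mult: "(1 - fps_const c * fps_X) * U = 1"
  unfolding U_def by (subst mult.commute) (rule inverse_mult_eq_1, simp)

lemma U_deriv: "fps_deriv U = fps_const c * U\<^sup>2"
  unfolding U_def by (subst fps_inverse_deriv) auto

text \<open>The factor 1 - c x clears the denominators in the product rule. The contributions of
  \<open>E\<close> and \<open>H\<close> combine to G - (1 - c x) G = c x G.\<close>

lemma G_deriv:
  "(1 - fps_const c * fps_X) * fps_deriv (G r) =
    fps_const c * fps_X * G r + of_nat r * fps_const c * (G r + G (r - 1))"
proof -
  define k where "k = fps_const c"
  define Y where "Y = k * fps_X * U"
  define E :: "'a fps" where "E = fps_exp (- 1)"
  have "fps_deriv Y = k * U * (1 + Y)"
    by (simp add: Y_def k_def U_deriv algebra_simps power2_eq_square)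
  moreover have "(1 - k * fps_X) * U = 1" using U_mult by (simp add: k_def)
  ultimately have Y': "(1 - k * fps_X) * fps_deriv Y = k * (1 + Y)"
    by (metis (no_types) mult.assoc mult.commute mult.right_neutral)
  have E': "fps_deriv E = - E" by (simp add: E_def flip: fps_const_neg)
  have H': "(1 - k * fps_X) * fps_deriv H = H" using H_deriv by (simp add: k_def)
  have G: "G r = E * Y ^ r * H" for r by (simp add: G_def E_def Y_def k_def)
  have "(1 - k * fps_X) * fps_deriv (G r) =
      E * Y ^ r * ((1 - k * fps_X) * fps_deriv H) - (1 - k * fps_X) * G r
      + of_nat r * ((1 - k * fps_X) * fps_deriv Y) * E * Y ^ (r - 1) * H"
    by (simp add: G E' fps_deriv_power' algebra_simps)
  also have "\<dots> = k * fps_X * G r + of_nat r * k * (1 + Y) * E * Y ^ (r - 1) * H"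
    unfolding Y' H' by (simp add: G algebra_simps)
  \<comment> \<open>At \<open>r = 0\<close> the index \<open>r - 1\<close> truncates, but the factor
    \<open>of_nat r\<close> removes that term.\<close>
  also have "of_nat r * k * (1 + Y) * E * Y ^ (r - 1) * H = of_nat r * k * (G r + G (r - 1))"
    by (cases r) (simp_all add: G algebra_simps)
  finally show ?thesis by (simp add: k_def)
qed

text \<open>Comparison of coefficients of x^n; moving the term c x G' to the right turns the factor
  r into r + n.\<close>

lemma G_nth_Suc:
  "of_nat (Suc n) * G r $ Suc n =
    c * (of_nat (r + n) * G r $ n + (if n = 0 then 0 else G r $ (n - 1)) + of_nat r * G (r - 1) $ n)"
proof -
  have "((1 - fps_const c * fps_X) * fps_deriv (G r)) $ n =
      (fps_const c * fps_X * G r + of_nat r * fps_const c * (G r + G (r - 1))) $ n"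
    by (simp only: G_deriv)
  then show ?thesis
    by (cases n) (simp_all add: algebra_simps fps_of_nat[symmetric])
qed

lemma G_nth_0: "G r $ 0 = (if r = 0 then 1 else 0)"
  by (simp add: G_def H_0)

text \<open>Strong induction is needed: removing a point \<open>b\<close> outside \<open>R\<close>
  along with \<open>a\<close> lowers \<open>card (S - R)\<close> by two.\<close>

lemma weighted_count_eq:
  assumes "finite S" "R \<subseteq> S"
  shows "weighted_count c S R = fact (card (S - R)) * G (card R) $ card (S - R)"
  using assms
proof (induction "card (S - R)" arbitrary: S R rule: less_induct)
  case less
  note fin = \<open>finite S\<close> and R = \<open>R \<subseteq> S\<close>
  have finR: "finite R" using fin R by (rule rev_finite_subset)
  show ?case
  proof (cases "S = R")
    case True
    then show ?thesis using finR
      by (simp add: weighted_count_def separated_derangements_same G_nth_0 parity_weight_def)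
  next
    case False
    then obtain a where a: "a \<in> S" "a \<notin> R" using R by auto
    define T where "T = S - {a}"
    define m r where "m = card (T - R)" and "r = card R"
    have S: "S = insert a T" "a \<notin> T" and finT: "finite T" and RT: "R \<subseteq> T"
      using a R fin by (auto simp: T_def)
    have SR: "S - R = insert a (T - R)" using a S by auto
    then have card: "card (S - R) = Suc m" using S finT by (simp add: m_def)
    have IH0: "weighted_count c T R = fact m * G r $ m"
      using less.hyps[of T R] card finT RT by (simp add: m_def r_def)
    \<comment> \<open>A distinguished \<open>b\<close> leaves both sets, so the number of other
      points stays \<open>m\<close>.\<close>
    have IH1: "weighted_count c (T - {b}) (R - {b}) = fact m * G (r - 1) $ m" if "b \<in> R" for b
    proof -
      have "T - {b} - (R - {b}) = T - R" using that by auto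
      with less.hyps[of "T - {b}" "R - {b}"] card finT finR RT that show ?thesis
        by (auto simp: m_def r_def)
    qed
    have IH2: "weighted_count c (T - {b}) (R - {b}) = fact (m - 1) * G r $ (m - 1)"
      if "b \<in> T - R" for b
    proof -
      have "R - {b} = R" "T - {b} - R = T - R - {b}" "R \<subseteq> T - {b}" using RT that by auto
      moreover have "card (T - R - {b}) = m - 1" using that finT by (simp add: m_def)
      ultimately show ?thesis
        using less.hyps[of "T - {b}" R] card finT RT that by (auto simp: r_def)
    qed
    \<comment> \<open>At \<open>m = 0\<close> the truncated \<open>m - 1\<close> is harmless, being
      multiplied by \<open>of_nat m\<close>.\<close>
    have sumT: "(\<Sum>b\<in>T. weighted_count c (T - {b}) (R - {b})) =
        of_nat r * (fact m * G (r - 1) $ m) + of_nat m * (fact (m - 1) * G r $ (m - 1))"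
    proof -
      have "(\<Sum>b\<in>R. weighted_count c (T - {b}) (R - {b})) =
          of_nat r * (fact m * G (r - 1) $ m)"
        by (subst sum.cong[OF refl IH1]) (simp_all add: r_def)
      moreover have "(\<Sum>b\<in>T - R. weighted_count c (T - {b}) (R - {b})) =
          of_nat m * (fact (m - 1) * G r $ (m - 1))"
        by (subst sum.cong[OF refl IH2]) (simp_all add: m_def)
      ultimately show ?thesis
        by (subst sum.subset_diff[OF RT finT]) (simp add: add.commute)
    qed
    have cT: "card T = r + m"
      using finT RT card_mono[OF finT RT] by (simp add: r_def m_def card_Diff_subset finR)
    have "weighted_count c S R = c * (of_nat (r + m) * (fact m * G r $ m)
        + of_nat r * (fact m * G (r - 1) $ m) + of_nat m * (fact (m - 1) * G r $ (m - 1)))"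
      unfolding S(1) weighted_count_insert[OF finT S(2) RT c_square]
      by (simp add: sum.distrib IH0 cT sumT)
    also have "\<dots> = fact m * (of_nat (Suc m) * G r $ Suc m)"
      unfolding G_nth_Suc by (cases m) (simp_all add: algebra_simps)
    finally show ?thesis by (simp add: card r_def algebra_simps)
  qed
qed

lemma Abs_fps_weighted_count:
  "Abs_fps (\<lambda>n. weighted_count c {1..r + n} {1..r} / fact n) = G r"
proof (rule fps_ext)
  fix n
  have "{1..r + n} - {1..r} = {r + 1..r + n}" by auto
  then show "Abs_fps (\<lambda>n. weighted_count c {1..r + n} {1..r} / fact n) $ n = G r $ n"
    by (simp add: weighted_count_eq)
qed

end

lemma parity_number_eq_weighted_count:
  assumes "i \<in> {0, 1}"
  shows "of_nat (r_derangement_parity_number i r n) =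
    (weighted_count 1 {1..r + n} {1..r} + (- 1) ^ i * weighted_count (- 1) {1..r + n} {1..r})
      / (2 :: 'a::field_char_0)"
proof -
  let ?D = "separated_derangements {1..r + n} {1..r}"
  \<comment> \<open>The combined weight of a permutation is 2 if its parity is \<open>i\<close> and
    0 otherwise.\<close>
  have "weighted_count 1 {1..r + n} {1..r} + (- 1) ^ i * weighted_count (- 1) {1..r + n} {1..r} =
      (\<Sum>p\<in>?D. if evenperm p \<longleftrightarrow> i = 0 then 2 else 0 :: 'a)"
    unfolding weighted_count_def sum_distrib_left sum.distrib[symmetric]
    by (rule sum.cong[OF refl]) (use assms in \<open>auto simp: parity_weight_def\<close>)
  also have "\<dots> = 2 * of_nat (card {p\<in>?D. evenperm p \<longleftrightarrow> i = 0})"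
    by (subst sum.inter_filter[symmetric]) (simp_all add: finite_separated_derangements)
  finally show ?thesis
    by (simp add: r_derangement_parity_number_def r_derangements_eq)
qed

theorem theorem7p6:
  fixes r i :: nat
  assumes "i \<in> {0, 1}"
  shows "Abs_fps (\<lambda>n. of_nat (r_derangement_parity_number i r n) / fact n) =
    (fps_const (1 / 2) *
      (fps_X ^ r * fps_exp (- 1) / (1 - fps_X) ^ (r + 1)
       + (- 1) ^ (r + i) * (fps_X ^ r * fps_exp (- 1) / (1 + fps_X) powi (int r - 1)))
     :: 'a::field_char_0 fps)"
proof -
  define V W :: "'a fps" where "V = inverse (1 - fps_X)" and "W = inverse (1 + fps_X)"
  have V: "(1 - fps_X) * V = 1"
    unfolding V_def by (subst mult.commute) (rule inverse_mult_eq_1, simp)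
  have W: "(1 + fps_X) * W = 1"
    unfolding W_def by (subst mult.commute) (rule inverse_mult_eq_1, simp)
  have "fps_deriv V = V\<^sup>2"
    unfolding V_def by (subst fps_inverse_deriv) auto
  then have "(1 - fps_X) * fps_deriv V = (1 - fps_X) * V * V"
    by (simp add: power2_eq_square mult.assoc)
  then interpret even: parity_gf 1 V
    by unfold_locales (use V in \<open>simp_all add: V_def\<close>)
  \<comment> \<open>For c = -1 the power (1 - c x)^(-c) is the polynomial 1 + x.\<close>
  interpret odd: parity_gf "- 1" "1 + fps_X :: 'a fps"
    by unfold_locales (simp_all flip: fps_const_neg)
  have even_G: "even.G r = fps_X ^ r * fps_exp (- 1) / (1 - fps_X) ^ (r + 1)"
  proof -
    have "even.U = V" by (simp add: even.U_def V_def)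
    moreover have "fps_X ^ r * fps_exp (- 1) / (1 - fps_X) ^ (r + 1) =
        fps_X ^ r * fps_exp (- 1) * V ^ (r + 1)"
      unfolding V_def fps_inverse_power[symmetric]
      by (rule fps_divide_unit) (simp add: fps_power_zeroth)
    ultimately show ?thesis by (simp add: even.G_def power_mult_distrib algebra_simps)
  qed
  have odd_G: "odd.G r =
      (- 1) ^ r * (fps_X ^ r * fps_exp (- 1) / (1 + fps_X) powi (int r - 1))"
  proof -
    have "fps_X ^ r * fps_exp (- 1) / (1 + fps_X) powi (int r - 1) =
        fps_X ^ r * fps_exp (- 1) * (W ^ r * (1 + fps_X))"
    \<comment> \<open>The exponent \<open>int r - 1\<close> is negative exactly for
      \<open>r = 0\<close>, where dividing by the power means multiplying by 1 + x.\<close>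
    proof (cases r)
      case 0
      have "fps_exp (- 1) / inverse (1 + fps_X) = fps_exp (- 1) * (1 + fps_X :: 'a fps)"
        by (subst fps_divide_unit) (simp_all add: fps_inverse_idempotent)
      with 0 show ?thesis by (simp add: power_int_minus)
    next
      case (Suc k)
      have "fps_X ^ r * fps_exp (- 1) / (1 + fps_X) ^ k = fps_X ^ r * fps_exp (- 1) * W ^ k"
        unfolding W_def fps_inverse_power[symmetric]
        by (rule fps_divide_unit) (simp add: fps_power_zeroth)
      moreover have "W ^ Suc k * (1 + fps_X) = W ^ k"
        using W by (simp add: mult.assoc mult.commute)
      ultimately show ?thesis using Suc by (simp add: power_int_def)
    qed
    moreover have "odd.U = W" by (simp add: odd.U_def W_def flip: fps_const_neg)
    \<comment> \<open>The sign (-1)^r of the theorem arises here, from (c x)^r at c = -1.\<close>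
    moreover have "(- (fps_X * W)) ^ r = (- 1) ^ r * (fps_X ^ r * W ^ r)"
      by (simp add: power_minus[of "fps_X * W"] power_mult_distrib)
    ultimately show ?thesis
      by (simp add: odd.G_def mult_ac flip: fps_const_neg)
  qed
  have "Abs_fps (\<lambda>n. of_nat (r_derangement_parity_number i r n) / fact n) =
      fps_const (1 / 2) * (even.G r + fps_const ((- 1) ^ i) * odd.G r)"
    unfolding even.Abs_fps_weighted_count[symmetric] odd.Abs_fps_weighted_count[symmetric]
    by (rule fps_ext) (simp add: parity_number_eq_weighted_count[OF assms] field_simps)
  also have "fps_const ((- 1) ^ i) = (- 1 :: 'a fps) ^ i"
    by (simp add: fps_const_power[symmetric] flip: fps_const_neg)
  finally show ?thesis
    by (simp add: even_G odd_G power_add mult_ac)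
qed

end
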